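(* Let $A$ be a commutative ring, $\mathfrak{a} \subseteq A$ a finitely generated ideal, and $\mathfrak{b} \subseteq A$ an ideal such that $\mathfrak{a} \subseteq \mathfrak{b}$. Let $M$ be an $A$-module. If $M$ is $\mathfrak{b}$-adically complete, then it is $\mathfrak{a}$-adically complete.
   Context: No noetherian hypothesis on $A$ and no finite generation hypothesis on $M$ is made. For an ideal $\mathfrak{c} \subseteq A$, the $A$-module $M$ is called $\mathfrak{c}$-adically complete if the canonical homomorphism $M \to \varprojlim_{i} M/\mathfrak{c}^i \cdot M$ is an isomorphism (so completeness includes separatedness). *)

theory Defs
  imports "HOL-Algebra.Ideal_Product" "HOL-Algebra.Module"
begin

text \<open>
  The record type of modules extends that of rings, so it has fields \<^const>\<open>mult\<close> and
  \<^const>\<open>one\<close>. These play no role for modules and are left \<^const>\<open>undefined\<close> below.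
\<close>

definition module_hom ::
    "('a, 'r) ring_scheme \<Rightarrow> ('a, 'b, 'm) module_scheme \<Rightarrow> ('a, 'c, 'n) module_scheme \<Rightarrow> ('b \<Rightarrow> 'c) set"
  where "module_hom R M N =
    {h \<in> carrier M \<rightarrow> carrier N.
       (\<forall>x \<in> carrier M. \<forall>y \<in> carrier M. h (x \<oplus>\<^bsub>M\<^esub> y) = h x \<oplus>\<^bsub>N\<^esub> h y) \<and>
       (\<forall>r \<in> carrier R. \<forall>x \<in> carrier M. h (r \<odot>\<^bsub>M\<^esub> x) = r \<odot>\<^bsub>N\<^esub> h x)}"

definition module_iso ::
    "('a, 'r) ring_scheme \<Rightarrow> ('a, 'b, 'm) module_scheme \<Rightarrow> ('a, 'c, 'n) module_scheme \<Rightarrow> ('b \<Rightarrow> 'c) set"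
  where "module_iso R M N = {h \<in> module_hom R M N. bij_betw h (carrier M) (carrier N)}"

text \<open>
  \<open>ideal_smult I M\<close> is \<open>I \<cdot> M\<close>, the set of finite sums of products \<open>a \<odot> x\<close> with \<open>a \<in> I\<close> and
  \<open>x \<in> M\<close>, in the style of \<^const>\<open>ideal_prod\<close>. The empty sum needs no rule of its own, since
  an ideal contains zero.
\<close>

inductive_set ideal_smult :: "'a set \<Rightarrow> ('a, 'b, 'm) module_scheme \<Rightarrow> 'b set"
  for I and M where
    smult: "\<lbrakk> a \<in> I; x \<in> carrier M \<rbrakk> \<Longrightarrow> a \<odot>\<^bsub>M\<^esub> x \<in> ideal_smult I M"
  | sum: "\<lbrakk> x \<in> ideal_smult I M; y \<in> ideal_smult I M \<rbrakk> \<Longrightarrow> x \<oplus>\<^bsub>M\<^esub> y \<in> ideal_smult I M"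

text \<open>The quotient module \<open>M / N\<close>, for a submodule \<open>N\<close>.\<close>

definition quotient_module :: "('a, 'b, 'm) module_scheme \<Rightarrow> 'b set \<Rightarrow> ('a, 'b set) module"
  where "quotient_module M N =
    \<lparr> carrier = a_rcosets\<^bsub>M\<^esub> N, mult = undefined, one = undefined,
      zero = N, add = set_add M,
      smult = (\<lambda>r X. \<Union>x \<in> X. N +>\<^bsub>M\<^esub> (r \<odot>\<^bsub>M\<^esub> x)) \<rparr>"

text \<open>
  For submodules \<open>K \<subseteq> N\<close>, the map \<open>quotient_proj M N\<close> is the projection \<open>M / K \<rightarrow> M / N\<close>:
  it sends a coset of \<open>K\<close> to the coset of \<open>N\<close> containing it.
\<close>

definition quotient_proj :: "('a, 'b, 'm) module_scheme \<Rightarrow> 'b set \<Rightarrow> 'b set \<Rightarrow> 'b set"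
  where "quotient_proj M N X = (\<Union>x \<in> X. N +>\<^bsub>M\<^esub> x)"

text \<open>
  The limit of the inverse system \<open>Q\<close> of modules with transition maps
  \<open>p i j : Q j \<rightarrow> Q i\<close> for \<open>i \<le> j\<close>.
\<close>

definition inverse_limit ::
    "(nat \<Rightarrow> ('a, 'b, 'm) module_scheme) \<Rightarrow> (nat \<Rightarrow> nat \<Rightarrow> 'b \<Rightarrow> 'b) \<Rightarrow> ('a, nat \<Rightarrow> 'b) module"
  where "inverse_limit Q p =
    \<lparr> carrier = {x. (\<forall>i. x i \<in> carrier (Q i)) \<and> (\<forall>i j. i \<le> j \<longrightarrow> p i j (x j) = x i)},
      mult = undefined, one = undefined,
      zero = (\<lambda>i. \<zero>\<^bsub>Q i\<^esub>), add = (\<lambda>x y i. x i \<oplus>\<^bsub>Q i\<^esub> y i),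
      smult = (\<lambda>r x i. r \<odot>\<^bsub>Q i\<^esub> x i) \<rparr>"

text \<open>
  \<open>adic_submodule R I M i\<close> is \<open>I\<^sup>i \<cdot> M\<close>. The power is taken in the monoid of ideals of \<open>R\<close>
  under \<^const>\<open>ideal_prod\<close>, whose unit is \<open>carrier R\<close>, so \<open>I\<^sup>0 = R\<close>.
\<close>

definition adic_submodule ::
    "('a, 'r) ring_scheme \<Rightarrow> 'a set \<Rightarrow> ('a, 'b, 'm) module_scheme \<Rightarrow> nat \<Rightarrow> 'b set"
  where "adic_submodule R I M i = ideal_smult (I [^]\<^bsub>ideals_set R\<^esub> i) M"

definition adic_limit ::
    "('a, 'r) ring_scheme \<Rightarrow> 'a set \<Rightarrow> ('a, 'b, 'm) module_scheme \<Rightarrow> ('a, nat \<Rightarrow> 'b set) module"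
  where "adic_limit R I M =
    inverse_limit (\<lambda>i. quotient_module M (adic_submodule R I M i))
      (\<lambda>i j. quotient_proj M (adic_submodule R I M i))"

definition adic_canonical ::
    "('a, 'r) ring_scheme \<Rightarrow> 'a set \<Rightarrow> ('a, 'b, 'm) module_scheme \<Rightarrow> 'b \<Rightarrow> nat \<Rightarrow> 'b set"
  where "adic_canonical R I M x = (\<lambda>i. adic_submodule R I M i +>\<^bsub>M\<^esub> x)"

definition adically_complete ::
    "('a, 'r) ring_scheme \<Rightarrow> 'a set \<Rightarrow> ('a, 'b, 'm) module_scheme \<Rightarrow> bool"
  where "adically_complete R I M \<longleftrightarrow> adic_canonical R I M \<in> module_iso R M (adic_limit R I M)"

end

theory Submission
  imports Defs
begin

text \<open>
  Completeness means that the filtration is separated and that every sequence with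
  \<open>x\<^sub>k\<^sub>+\<^sub>1 - x\<^sub>k \<in> I\<^sup>k M\<close> for all \<open>k\<close> has a limit \<open>y\<close> with \<open>y - x\<^sub>k \<in> I\<^sup>k M\<close>. Separatedness passes to
  the smaller ideal at once, and a sequence that is Cauchy for \<open>\<aa>\<close> has a \<open>\<bb>\<close>-adic limit \<open>y\<close>; the
  point is that \<open>y - x\<^sub>i\<close> lies in \<open>\<aa>\<^sup>i M\<close>. To gain one power of \<open>\<aa>\<close>, write each difference
  \<open>x\<^sub>k\<^sub>+\<^sub>1 - x\<^sub>k\<close> as a combination of the finitely many generators of \<open>\<aa>\<close> and sum the coefficients
  of each generator \<open>\<bb>\<close>-adically. By \<open>\<bb>\<close>-adic separatedness, the combination of these sums is
  \<open>y - x\<^sub>i\<close>.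
\<close>

context module
begin

section \<open>Differences of elements and congruence modulo a submodule\<close>

lemma smult_diff_right:
  assumes "a \<in> carrier R" "x \<in> carrier M" "y \<in> carrier M"
  shows "a \<odot>\<^bsub>M\<^esub> (x \<ominus>\<^bsub>M\<^esub> y) = a \<odot>\<^bsub>M\<^esub> x \<ominus>\<^bsub>M\<^esub> a \<odot>\<^bsub>M\<^esub> y"
  using assms by (simp add: M.minus_eq smult_r_distr smult_r_minus)

lemma submodule_diff_closed:
  assumes "submodule N R M" "x \<in> N" "y \<in> N"
  shows "x \<ominus>\<^bsub>M\<^esub> y \<in> N"
  using assms submoduleE by (simp add: M.minus_eq)

lemma submodule_zero_closed:
  assumes "submodule N R M"
  shows "\<zero>\<^bsub>M\<^esub> \<in> N"
  using subgroup.one_closed[OF submodule.axioms(1)[OF assms]] by simp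

lemma diff_zero:
  assumes "x \<in> carrier M"
  shows "x \<ominus>\<^bsub>M\<^esub> \<zero>\<^bsub>M\<^esub> = x"
  using assms by (simp add: M.minus_eq)

lemma eq_if_diff_zero:
  assumes "x \<in> carrier M" "y \<in> carrier M" "x \<ominus>\<^bsub>M\<^esub> y = \<zero>\<^bsub>M\<^esub>"
  shows "x = y"
  using assms M.add.inv_solve_right'[of "\<zero>\<^bsub>M\<^esub>" x y] by (simp add: M.minus_eq)

lemma add_diff_cancel:
  assumes "x \<in> carrier M" "y \<in> carrier M"
  shows "x \<oplus>\<^bsub>M\<^esub> (y \<ominus>\<^bsub>M\<^esub> x) = y"
  using assms by (simp add: M.minus_eq M.a_comm[of y] M.r_neg2)

lemma diff_add_cancel:
  assumes "x \<in> carrier M" "y \<in> carrier M"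
  shows "(y \<ominus>\<^bsub>M\<^esub> x) \<oplus>\<^bsub>M\<^esub> x = y"
  using assms by (simp add: M.minus_eq M.a_assoc M.l_neg)

lemma diff_add_diff:
  assumes "x \<in> carrier M" "y \<in> carrier M" "z \<in> carrier M"
  shows "(x \<ominus>\<^bsub>M\<^esub> y) \<oplus>\<^bsub>M\<^esub> (y \<ominus>\<^bsub>M\<^esub> z) = x \<ominus>\<^bsub>M\<^esub> z"
  using assms by (simp add: M.minus_eq M.a_assoc M.r_neg1)

lemma minus_diff:
  assumes "x \<in> carrier M" "y \<in> carrier M"
  shows "\<ominus>\<^bsub>M\<^esub> (x \<ominus>\<^bsub>M\<^esub> y) = y \<ominus>\<^bsub>M\<^esub> x"
  using assms by (simp add: M.minus_eq M.minus_add M.a_comm)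

lemma diff_diff_diff:
  assumes "x \<in> carrier M" "y \<in> carrier M" "z \<in> carrier M"
  shows "(x \<ominus>\<^bsub>M\<^esub> z) \<ominus>\<^bsub>M\<^esub> (y \<ominus>\<^bsub>M\<^esub> z) = x \<ominus>\<^bsub>M\<^esub> y"
  using assms diff_add_diff[of x z y] minus_diff[of y z] by (simp add: M.minus_eq)

lemma diff_add_eq_diff_diff:
  assumes "x \<in> carrier M" "y \<in> carrier M" "z \<in> carrier M"
  shows "x \<ominus>\<^bsub>M\<^esub> (y \<oplus>\<^bsub>M\<^esub> z) = (x \<ominus>\<^bsub>M\<^esub> y) \<ominus>\<^bsub>M\<^esub> z"
  using assms by (simp add: M.minus_eq M.minus_add M.a_assoc)

lemma submodule_diff_trans:
  assumes "submodule N R M" "x \<in> carrier M" "y \<in> carrier M" "z \<in> carrier M"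
    and "x \<ominus>\<^bsub>M\<^esub> y \<in> N" "y \<ominus>\<^bsub>M\<^esub> z \<in> N"
  shows "x \<ominus>\<^bsub>M\<^esub> z \<in> N"
  using assms diff_add_diff submoduleE(5) by metis

lemma submodule_diff_commute:
  assumes "submodule N R M" "x \<in> carrier M" "y \<in> carrier M" "x \<ominus>\<^bsub>M\<^esub> y \<in> N"
  shows "y \<ominus>\<^bsub>M\<^esub> x \<in> N"
  using assms minus_diff submoduleE(3) by metis

section \<open>Cosets and quotient modules\<close>

lemma abelian_subgroup_submodule:
  assumes "submodule N R M"
  shows "abelian_subgroup N M"
  using abelian_subgroupI3 additive_subgroupI assms M.abelian_group_axioms submodule.axioms(1)
  by blast

lemma mem_rcoset_iff:
  assumes "submodule N R M" "x \<in> carrier M"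
  shows "y \<in> N +>\<^bsub>M\<^esub> x \<longleftrightarrow> y \<in> carrier M \<and> y \<ominus>\<^bsub>M\<^esub> x \<in> N"
proof
  assume "y \<in> N +>\<^bsub>M\<^esub> x"
  then obtain n where n: "n \<in> N" "y = n \<oplus>\<^bsub>M\<^esub> x"
    by (auto simp: a_r_coset_def')
  then have "n \<in> carrier M"
    using assms submoduleE(1) by blast
  then show "y \<in> carrier M \<and> y \<ominus>\<^bsub>M\<^esub> x \<in> N"
    using n assms by (simp add: M.minus_eq M.a_assoc M.r_neg)
next
  assume y: "y \<in> carrier M \<and> y \<ominus>\<^bsub>M\<^esub> x \<in> N"
  then have "y = (y \<ominus>\<^bsub>M\<^esub> x) \<oplus>\<^bsub>M\<^esub> x"
    using assms by (simp add: diff_add_cancel)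
  then show "y \<in> N +>\<^bsub>M\<^esub> x"
    using y unfolding a_r_coset_def' by blast
qed

lemma rcoset_eq_iff:
  assumes "submodule N R M" "x \<in> carrier M" "y \<in> carrier M"
  shows "N +>\<^bsub>M\<^esub> x = N +>\<^bsub>M\<^esub> y \<longleftrightarrow> x \<ominus>\<^bsub>M\<^esub> y \<in> N"
proof
  assume "N +>\<^bsub>M\<^esub> x = N +>\<^bsub>M\<^esub> y"
  moreover have "x \<ominus>\<^bsub>M\<^esub> x \<in> N"
    using assms submodule_zero_closed by (simp add: M.minus_eq M.r_neg)
  ultimately show "x \<ominus>\<^bsub>M\<^esub> y \<in> N"
    using assms mem_rcoset_iff by blast
next
  assume "x \<ominus>\<^bsub>M\<^esub> y \<in> N"
  moreover from this have "y \<ominus>\<^bsub>M\<^esub> x \<in> N"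
    by (rule submodule_diff_commute[OF assms])
  ultimately have "z \<in> N +>\<^bsub>M\<^esub> x \<longleftrightarrow> z \<in> N +>\<^bsub>M\<^esub> y" for z
    using submodule_diff_trans[OF assms(1), of z x y] submodule_diff_trans[OF assms(1), of z y x] assms
    by (auto simp: mem_rcoset_iff)
  then show "N +>\<^bsub>M\<^esub> x = N +>\<^bsub>M\<^esub> y"
    by blast
qed

lemma rcoset_self:
  assumes "submodule N R M" "x \<in> carrier M"
  shows "x \<in> N +>\<^bsub>M\<^esub> x"
  using assms submodule_zero_closed by (simp add: mem_rcoset_iff M.minus_eq M.r_neg)

text \<open>Since K is contained in N, all members of \<open>K +> x\<close> have the same coset
  modulo N, and x is one of them. So the union in \<open>quotient_proj\<close> is over a nonempty
  family of equal sets.\<close>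

lemma quotient_proj_rcoset:
  assumes "submodule K R M" "submodule N R M" "K \<subseteq> N" "x \<in> carrier M"
  shows "quotient_proj M N (K +>\<^bsub>M\<^esub> x) = N +>\<^bsub>M\<^esub> x"
proof -
  have "N +>\<^bsub>M\<^esub> y = N +>\<^bsub>M\<^esub> x" if "y \<in> K +>\<^bsub>M\<^esub> x" for y
    using that assms mem_rcoset_iff rcoset_eq_iff by blast
  then show ?thesis
    unfolding quotient_proj_def using rcoset_self[OF assms(1,4)] by blast
qed

text \<open>Scalar multiplication in the quotient is a union over all representatives. Two
  representatives x and y of one coset give r y - r x = r (y - x) in N, so the union collapses to a
  single coset.\<close>

lemma rcoset_quotient_module_hom:
  assumes N: "submodule N R M"
  shows "(\<lambda>x. N +>\<^bsub>M\<^esub> x) \<in> module_hom R M (quotient_module M N)"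
proof -
  interpret abelian_subgroup N M
    using N by (rule abelian_subgroup_submodule)
  have "(\<Union>y \<in> N +>\<^bsub>M\<^esub> x. N +>\<^bsub>M\<^esub> (r \<odot>\<^bsub>M\<^esub> y)) = N +>\<^bsub>M\<^esub> (r \<odot>\<^bsub>M\<^esub> x)"
    if r: "r \<in> carrier R" and x: "x \<in> carrier M" for r x
  proof -
    have "N +>\<^bsub>M\<^esub> (r \<odot>\<^bsub>M\<^esub> y) = N +>\<^bsub>M\<^esub> (r \<odot>\<^bsub>M\<^esub> x)" if "y \<in> N +>\<^bsub>M\<^esub> x" for y
    proof -
      have y: "y \<in> carrier M" "y \<ominus>\<^bsub>M\<^esub> x \<in> N"
        using that mem_rcoset_iff[OF N x] by auto
      then have "r \<odot>\<^bsub>M\<^esub> (y \<ominus>\<^bsub>M\<^esub> x) \<in> N"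
        using submoduleE(4)[OF N r] by blast
      then show ?thesis
        using r x y by (simp add: rcoset_eq_iff[OF N] smult_diff_right)
    qed
    then show ?thesis
      using rcoset_self[OF N x] by blast
  qed
  then show ?thesis
    unfolding module_hom_def quotient_module_def
    by (auto simp: a_rcos_sum A_RCOSETS_def')
qed

section \<open>The filtration of M by the submodules I^n M\<close>

lemma submodule_ideal_smult:
  assumes "ideal I R"
  shows "submodule (ideal_smult I M) R M"
proof (rule submoduleI)
  interpret ideal I R by fact
  show sub: "ideal_smult I M \<subseteq> carrier M"
  proof
    fix x assume "x \<in> ideal_smult I M"
    then show "x \<in> carrier M" by induction auto
  qed
  show "\<zero>\<^bsub>M\<^esub> \<in> ideal_smult I M"
    using ideal_smult.smult[of \<zero> I "\<zero>\<^bsub>M\<^esub>" M] by simp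
  show smult: "r \<odot>\<^bsub>M\<^esub> x \<in> ideal_smult I M" if r: "r \<in> carrier R" and "x \<in> ideal_smult I M" for r x
    using that(2)
  proof induction
    case (smult a x)
    then have "r \<odot>\<^bsub>M\<^esub> (a \<odot>\<^bsub>M\<^esub> x) = (r \<otimes> a) \<odot>\<^bsub>M\<^esub> x"
      using r by (simp add: smult_assoc1)
    then show ?case
      using smult r by (simp add: I_l_closed ideal_smult.smult)
  next
    case (sum x y)
    then have "x \<in> carrier M" "y \<in> carrier M" using sub by auto
    then show ?case
      using sum r by (simp add: smult_r_distr ideal_smult.sum)
  qed
  show "\<ominus>\<^bsub>M\<^esub> x \<in> ideal_smult I M" if "x \<in> ideal_smult I M" for x
    using that smult[of "\<ominus> \<one>" x] sub by (auto simp: smult_l_minus)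
qed (rule ideal_smult.sum)

lemma ideal_smult_mono:
  assumes "I \<subseteq> J"
  shows "ideal_smult I M \<subseteq> ideal_smult J M"
proof
  fix x assume "x \<in> ideal_smult I M"
  then show "x \<in> ideal_smult J M"
    by induction (use assms in \<open>auto intro: ideal_smult.intros\<close>)
qed

lemma ideals_set_pow_0: "I [^]\<^bsub>ideals_set R\<^esub> (0::nat) = carrier R"
  by (simp add: nat_pow_def ideals_set_def)

lemma ideals_set_pow_Suc: "I [^]\<^bsub>ideals_set R\<^esub> Suc n = (I [^]\<^bsub>ideals_set R\<^esub> n) \<cdot> I"
  by (simp add: nat_pow_def ideals_set_def)

lemma ideal_ideals_set_pow:
  assumes "ideal I R"
  shows "ideal (I [^]\<^bsub>ideals_set R\<^esub> (n::nat)) R"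
  by (induction n)
    (simp_all only: ideals_set_pow_0 ideals_set_pow_Suc oneideal ideal_prod_is_ideal assms)

lemma ideals_set_pow_mono:
  assumes "I \<subseteq> J"
  shows "I [^]\<^bsub>ideals_set R\<^esub> (n::nat) \<subseteq> J [^]\<^bsub>ideals_set R\<^esub> n"
proof (induction n)
  case (Suc n)
  have "x \<in> (J [^]\<^bsub>ideals_set R\<^esub> n) \<cdot> J" if "x \<in> (I [^]\<^bsub>ideals_set R\<^esub> n) \<cdot> I" for x
    using that by induction (use Suc assms in \<open>auto intro: ideal_prod.intros\<close>)
  then show ?case
    unfolding ideals_set_pow_Suc by blast
qed (simp add: ideals_set_pow_0)

lemma submodule_adic:
  assumes "ideal I R"
  shows "submodule (adic_submodule R I M n) R M"
  unfolding adic_submodule_def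
  by (intro submodule_ideal_smult ideal_ideals_set_pow assms)

lemma adic_submodule_mono:
  assumes "I \<subseteq> J"
  shows "adic_submodule R I M n \<subseteq> adic_submodule R J M n"
  unfolding adic_submodule_def
  by (intro ideal_smult_mono ideals_set_pow_mono assms)

lemma adic_submodule_0: "adic_submodule R I M 0 = carrier M"
proof -
  have "x \<in> ideal_smult (carrier R) M" if "x \<in> carrier M" for x
    using that ideal_smult.smult[of \<one> "carrier R" x M] by simp
  then show ?thesis
    using submoduleE(1)[OF submodule_ideal_smult[OF oneideal]]
    unfolding adic_submodule_def ideals_set_pow_0 by blast
qed

text \<open>A product of two ideals lies in each factor, so the powers of I decrease, and with them
  the submodules.\<close>

lemma adic_submodule_antimono:
  assumes I: "ideal I R" and "m \<le> n"
  shows "adic_submodule R I M n \<subseteq> adic_submodule R I M m"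
  using \<open>m \<le> n\<close>
proof (induction rule: dec_induct)
  case (step n)
  have "I [^]\<^bsub>ideals_set R\<^esub> Suc n \<subseteq> I [^]\<^bsub>ideals_set R\<^esub> n"
    unfolding ideals_set_pow_Suc
    using ideal_prod_inter[OF ideal_ideals_set_pow[OF I] I] by blast
  then show ?case
    using step.IH ideal_smult_mono unfolding adic_submodule_def by blast
qed simp

text \<open>Multiplying by an element of I gains one power. This is the easy half of I^(n+1) M = I
  (I^n M); \<open>adic_submodule_Suc_finite\<close> is the half that uses finitely many
  generators.\<close>

lemma smult_adic_submodule_Suc:
  assumes I: "ideal I R" and a: "a \<in> I" and x: "x \<in> adic_submodule R I M n"
  shows "a \<odot>\<^bsub>M\<^esub> x \<in> adic_submodule R I M (Suc n)"
  using x unfolding adic_submodule_def ideals_set_pow_Suc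
proof induction
  case (smult p x)
  have aR: "a \<in> carrier R" and pR: "p \<in> carrier R"
    using I a smult ideal_ideals_set_pow[OF I] by (meson ideal.Icarr)+
  \<comment> \<open>\<open>ideals_set_pow_Suc\<close> puts the new factor on the right, hence the
    swap of a and p.\<close>
  then have "a \<odot>\<^bsub>M\<^esub> (p \<odot>\<^bsub>M\<^esub> x) = (p \<otimes> a) \<odot>\<^bsub>M\<^esub> x"
    using smult by (simp add: smult_assoc1 [symmetric] R.m_comm)
  then show ?case
    using smult a by (simp add: ideal_smult.smult ideal_prod.prod)
next
  case (sum x y)
  then have "x \<in> carrier M" "y \<in> carrier M"
    using submoduleE(1)[OF submodule_ideal_smult[OF ideal_ideals_set_pow[OF I]]] by blast+
  moreover have "a \<in> carrier R"
    using I a by (meson ideal.Icarr)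
  ultimately show ?case
    using sum by (simp add: smult_r_distr ideal_smult.sum)
qed

section \<open>Linear combinations of finitely many generators\<close>

lemma finsum_closed_submodule:
  assumes N: "submodule N R M" and "finite S" "f \<in> S \<rightarrow> N"
  shows "(\<Oplus>\<^bsub>M\<^esub>s\<in>S. f s) \<in> N"
  using assms(2,3)
proof (induction S rule: finite_induct)
  case (insert s S)
  then have "f \<in> S \<rightarrow> carrier M" "f s \<in> carrier M"
    using submoduleE(1)[OF N] by auto
  then show ?case
    using insert submoduleE(5)[OF N] by auto
qed (simp add: submodule_zero_closed[OF N])

text \<open>With N = I^n M and S generating I, this set will turn out to contain I^(n+1) M. There is
  exactly one coefficient per generator, so a sequence of such elements yields, for each generator,
  a sequence of coefficients that can be summed by itself.\<close>

lemma submodule_linear_combinations: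
  assumes N: "submodule N R M" and S: "finite S" "S \<subseteq> carrier R"
  shows "submodule {\<Oplus>\<^bsub>M\<^esub>s\<in>S. s \<odot>\<^bsub>M\<^esub> v s | v. v \<in> S \<rightarrow> N} R M" (is "submodule ?T R M")
proof (rule submoduleI)
  have NM: "N \<subseteq> carrier M"
    using submoduleE(1)[OF N] .
  have vM: "(\<lambda>s. s \<odot>\<^bsub>M\<^esub> v s) \<in> S \<rightarrow> carrier M" if "v \<in> S \<rightarrow> N" for v
    using that NM S(2) by auto
  show sub: "?T \<subseteq> carrier M"
    using vM by auto
  have T_I: "(\<Oplus>\<^bsub>M\<^esub>s\<in>S. s \<odot>\<^bsub>M\<^esub> v s) \<in> ?T" if "v \<in> S \<rightarrow> N" for v
    using that by (intro CollectI exI conjI) (rule refl)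
  show smult: "r \<odot>\<^bsub>M\<^esub> x \<in> ?T" if r: "r \<in> carrier R" and "x \<in> ?T" for r x
  proof -
    obtain v where v: "v \<in> S \<rightarrow> N" "x = (\<Oplus>\<^bsub>M\<^esub>s\<in>S. s \<odot>\<^bsub>M\<^esub> v s)"
      using \<open>x \<in> ?T\<close> by auto
    have "r \<odot>\<^bsub>M\<^esub> (s \<odot>\<^bsub>M\<^esub> v s) = s \<odot>\<^bsub>M\<^esub> (r \<odot>\<^bsub>M\<^esub> v s)" if "s \<in> S" for s
    proof -
      have "s \<in> carrier R" "v s \<in> carrier M"
        using that v(1) NM S(2) by auto
      then show ?thesis
        using r by (simp add: smult_assoc1 [symmetric] R.m_comm)
    qed
    then have "r \<odot>\<^bsub>M\<^esub> x = (\<Oplus>\<^bsub>M\<^esub>s\<in>S. s \<odot>\<^bsub>M\<^esub> (r \<odot>\<^bsub>M\<^esub> v s))"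
      using v NM S r finsum_smult_ldistr[OF S(1) r vM[OF v(1)]]
      by (auto intro!: M.finsum_cong' simp: Pi_iff subset_iff)
    moreover have "(\<lambda>s. r \<odot>\<^bsub>M\<^esub> v s) \<in> S \<rightarrow> N"
      using v(1) submoduleE(4)[OF N r] by auto
    ultimately show ?thesis
      using T_I[of "\<lambda>s. r \<odot>\<^bsub>M\<^esub> v s"] by simp
  qed
  show "x \<oplus>\<^bsub>M\<^esub> y \<in> ?T" if xy: "x \<in> ?T" "y \<in> ?T" for x y
  proof -
    obtain v w where v: "v \<in> S \<rightarrow> N" "x = (\<Oplus>\<^bsub>M\<^esub>s\<in>S. s \<odot>\<^bsub>M\<^esub> v s)"
      and w: "w \<in> S \<rightarrow> N" "y = (\<Oplus>\<^bsub>M\<^esub>s\<in>S. s \<odot>\<^bsub>M\<^esub> w s)"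
      using xy by auto
    have "x \<oplus>\<^bsub>M\<^esub> y = (\<Oplus>\<^bsub>M\<^esub>s\<in>S. s \<odot>\<^bsub>M\<^esub> v s \<oplus>\<^bsub>M\<^esub> s \<odot>\<^bsub>M\<^esub> w s)"
      unfolding v w by (rule M.finsum_addf [symmetric]) (rule vM v w)+
    also have "\<dots> = (\<Oplus>\<^bsub>M\<^esub>s\<in>S. s \<odot>\<^bsub>M\<^esub> (v s \<oplus>\<^bsub>M\<^esub> w s))"
      using v w NM S by (intro M.finsum_cong') (auto simp: smult_r_distr Pi_iff subset_iff)
    finally have "x \<oplus>\<^bsub>M\<^esub> y = (\<Oplus>\<^bsub>M\<^esub>s\<in>S. s \<odot>\<^bsub>M\<^esub> (v s \<oplus>\<^bsub>M\<^esub> w s))" .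
    moreover have "(\<lambda>s. v s \<oplus>\<^bsub>M\<^esub> w s) \<in> S \<rightarrow> N"
      using v(1) w(1) submoduleE(5)[OF N] by auto
    ultimately show ?thesis
      using T_I[of "\<lambda>s. v s \<oplus>\<^bsub>M\<^esub> w s"] by simp
  qed
  have "(\<Oplus>\<^bsub>M\<^esub>s\<in>S. s \<odot>\<^bsub>M\<^esub> \<zero>\<^bsub>M\<^esub>) = (\<Oplus>\<^bsub>M\<^esub>s\<in>S. \<zero>\<^bsub>M\<^esub>)"
    using S(2) by (intro M.finsum_cong') auto
  then show "\<zero>\<^bsub>M\<^esub> \<in> ?T"
    using T_I[of "\<lambda>s. \<zero>\<^bsub>M\<^esub>"] submodule_zero_closed[OF N] by simp
  show "\<ominus>\<^bsub>M\<^esub> x \<in> ?T" if "x \<in> ?T" for x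
  proof -
    have "x \<in> carrier M" using that sub by blast
    then have "\<ominus>\<^bsub>M\<^esub> x = (\<ominus> \<one>) \<odot>\<^bsub>M\<^esub> x" by (simp add: smult_l_minus)
    then show ?thesis using smult[OF _ that, of "\<ominus> \<one>"] by simp
  qed
qed

text \<open>This is the colon ideal (T : N). Because it is an ideal, it contains
  \<open>Idl S\<close> as soon as it contains S, which replaces an explicit description of the
  elements of \<open>Idl S\<close>.\<close>

lemma ideal_colon:
  assumes N: "N \<subseteq> carrier M" and T: "submodule T R M"
  shows "ideal {a \<in> carrier R. \<forall>x \<in> N. a \<odot>\<^bsub>M\<^esub> x \<in> T} R"
proof (rule idealI)
  show "ring R" by (rule R.ring_axioms)
  show "subgroup {a \<in> carrier R. \<forall>x \<in> N. a \<odot>\<^bsub>M\<^esub> x \<in> T} (add_monoid R)"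
  proof (rule R.add.subgroupI)
    show "{a \<in> carrier R. \<forall>x \<in> N. a \<odot>\<^bsub>M\<^esub> x \<in> T} \<noteq> {}"
      using N submodule_zero_closed[OF T] by (auto intro!: exI[of _ \<zero>] simp: subset_iff)
    fix a assume "a \<in> {a \<in> carrier R. \<forall>x \<in> N. a \<odot>\<^bsub>M\<^esub> x \<in> T}"
    then show "\<ominus> a \<in> {a \<in> carrier R. \<forall>x \<in> N. a \<odot>\<^bsub>M\<^esub> x \<in> T}"
      using N submoduleE(3)[OF T]
      by (auto simp: smult_l_minus subset_iff)
  qed (use N submoduleE(5)[OF T] in \<open>auto simp: smult_l_distr subset_iff\<close>)
  fix a r assume *: "a \<in> {a \<in> carrier R. \<forall>x \<in> N. a \<odot>\<^bsub>M\<^esub> x \<in> T}" "r \<in> carrier R"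
  then show "r \<otimes> a \<in> {a \<in> carrier R. \<forall>x \<in> N. a \<odot>\<^bsub>M\<^esub> x \<in> T}"
    using N submoduleE(4)[OF T] by (auto simp: smult_assoc1 subset_iff)
  then show "a \<otimes> r \<in> {a \<in> carrier R. \<forall>x \<in> N. a \<odot>\<^bsub>M\<^esub> x \<in> T}"
    using * by (simp add: R.m_comm)
qed

text \<open>The combinations of S with coefficients in N = I^n M form a submodule T. It contains s N
  for each generator s, hence I N by the colon ideal, hence all of I^(n+1) M.\<close>

lemma adic_submodule_Suc_finite:
  assumes S: "finite S" "S \<subseteq> carrier R" and I: "I = Idl S"
    and x: "x \<in> adic_submodule R I M (Suc n)"
  obtains v where "v \<in> S \<rightarrow> adic_submodule R I M n" "x = (\<Oplus>\<^bsub>M\<^esub>s\<in>S. s \<odot>\<^bsub>M\<^esub> v s)"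
proof -
  have idl: "ideal I R"
    unfolding I by (rule genideal_ideal) fact
  define N where "N = adic_submodule R I M n"
  have N: "submodule N R M"
    unfolding N_def by (rule submodule_adic) fact
  then have NM: "N \<subseteq> carrier M"
    by (rule submoduleE)
  define T where "T = {\<Oplus>\<^bsub>M\<^esub>s\<in>S. s \<odot>\<^bsub>M\<^esub> v s | v. v \<in> S \<rightarrow> N}"
  have T: "submodule T R M"
    unfolding T_def by (rule submodule_linear_combinations) fact+
  have "s \<odot>\<^bsub>M\<^esub> y \<in> T" if s: "s \<in> S" and y: "y \<in> N" for s y
  proof -
    \<comment> \<open>s y is the combination with the single coefficient y at s. The sum is then
      brought into the \<open>if s = t\<close> shape that \<open>finsum_singleton\<close>
      expects.\<close>
    let ?v = "\<lambda>t. if t = s then y else \<zero>\<^bsub>M\<^esub>"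
    have "(\<Oplus>\<^bsub>M\<^esub>t\<in>S. t \<odot>\<^bsub>M\<^esub> ?v t) = (\<Oplus>\<^bsub>M\<^esub>t\<in>S. if s = t then t \<odot>\<^bsub>M\<^esub> y else \<zero>\<^bsub>M\<^esub>)"
      using S y NM by (intro M.finsum_cong') (auto simp: subset_iff)
    also have "\<dots> = s \<odot>\<^bsub>M\<^esub> y"
      using S s y NM by (intro M.finsum_singleton) auto
    finally show ?thesis
      unfolding T_def using y submodule_zero_closed[OF N]
      by (intro CollectI exI[of _ ?v]) auto
  qed
  then have "S \<subseteq> {a \<in> carrier R. \<forall>x \<in> N. a \<odot>\<^bsub>M\<^esub> x \<in> T}"
    using S by auto
  then have "I \<subseteq> {a \<in> carrier R. \<forall>x \<in> N. a \<odot>\<^bsub>M\<^esub> x \<in> T}"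
    unfolding I by (intro genideal_minimal ideal_colon T NM)
  then have IN: "a \<odot>\<^bsub>M\<^esub> y \<in> T" if "a \<in> I" "y \<in> N" for a y
    using that by blast
  \<comment> \<open>Here y is any element of M. For p in I^n and q in I, regrouping (p q) y as q (p
    y) puts p y into N, where the previous fact applies.\<close>
  have prodT: "a \<odot>\<^bsub>M\<^esub> y \<in> T" if "a \<in> (I [^]\<^bsub>ideals_set R\<^esub> n) \<cdot> I" "y \<in> carrier M" for a y
    using that(1)
  proof induction
    case (prod p q)
    then have R: "p \<in> carrier R" "q \<in> carrier R"
      using idl ideal_ideals_set_pow[OF idl] by (meson ideal.Icarr)+
    have "p \<odot>\<^bsub>M\<^esub> y \<in> N"
      unfolding N_def adic_submodule_def using prod that(2) by (simp add: ideal_smult.smult)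
    moreover have "(p \<otimes> q) \<odot>\<^bsub>M\<^esub> y = q \<odot>\<^bsub>M\<^esub> (p \<odot>\<^bsub>M\<^esub> y)"
      using R that(2) by (simp add: smult_assoc1 [symmetric] R.m_comm)
    ultimately show ?case
      using prod IN by simp
  next
    case (sum a b)
    then have "a \<in> carrier R" "b \<in> carrier R"
      using ideal_prod_in_carrier[OF ideal_ideals_set_pow[OF idl] idl] by blast+
    then show ?case
      using sum that(2) submoduleE(5)[OF T] by (simp add: smult_l_distr)
  qed
  have "x \<in> T"
    using x unfolding adic_submodule_def ideals_set_pow_Suc
    by induction (use prodT submoduleE(5)[OF T] in auto)
  then show ?thesis
    using that unfolding T_def N_def by blast
qed

section \<open>Completeness in terms of elements and sequences\<close>

text \<open>The canonical map is always a homomorphism into the limit, so only bijectivity matters.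
  Two elements have the same image iff their difference lies in every I^i M, which turns injectivity
  into separatedness. Surjectivity becomes convergence on passing between compatible families of
  cosets and sequences of representatives.\<close>

lemma adically_complete_iff:
  assumes I: "ideal I R"
  shows "adically_complete R I M \<longleftrightarrow>
    (\<forall>x \<in> carrier M. (\<forall>i. x \<in> adic_submodule R I M i) \<longrightarrow> x = \<zero>\<^bsub>M\<^esub>) \<and>
    (\<forall>x. (\<forall>i. x i \<in> carrier M \<and> x (Suc i) \<ominus>\<^bsub>M\<^esub> x i \<in> adic_submodule R I M i) \<longrightarrow>
      (\<exists>y \<in> carrier M. \<forall>i. y \<ominus>\<^bsub>M\<^esub> x i \<in> adic_submodule R I M i))"
    (is "_ \<longleftrightarrow> ?separated \<and> ?convergent")
proof -
  let ?N = "adic_submodule R I M" and ?c = "adic_canonical R I M" and ?L = "adic_limit R I M"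
  note N = submodule_adic[OF I]
  have carrier_L: "carrier ?L = {X. (\<forall>i. X i \<in> a_rcosets\<^bsub>M\<^esub> (?N i)) \<and>
      (\<forall>i j. i \<le> j \<longrightarrow> quotient_proj M (?N i) (X j) = X i)}"
    by (simp add: adic_limit_def inverse_limit_def quotient_module_def)
  have rcosets_I: "?N i +>\<^bsub>M\<^esub> x \<in> a_rcosets\<^bsub>M\<^esub> (?N i)" if "x \<in> carrier M" for x i
    using that by (auto simp: A_RCOSETS_def')
  have c_mem: "?c x \<in> carrier ?L" if "x \<in> carrier M" for x
    using that rcosets_I
    by (simp add: carrier_L adic_canonical_def quotient_proj_rcoset[OF N N adic_submodule_antimono[OF I]])
  have "?c \<in> module_hom R M ?L"
    using c_mem rcoset_quotient_module_hom[OF N]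
    by (auto simp: module_hom_def adic_limit_def inverse_limit_def adic_canonical_def fun_eq_iff)
  then have "adically_complete R I M \<longleftrightarrow> inj_on ?c (carrier M) \<and> carrier ?L \<subseteq> ?c ` carrier M"
    using c_mem by (auto simp: adically_complete_def module_iso_def bij_betw_def)
  also have "inj_on ?c (carrier M) \<longleftrightarrow> ?separated"
  proof -
    have c_eq: "?c x = ?c y \<longleftrightarrow> (\<forall>i. x \<ominus>\<^bsub>M\<^esub> y \<in> ?N i)" if "x \<in> carrier M" "y \<in> carrier M" for x y
      using that by (simp add: adic_canonical_def fun_eq_iff rcoset_eq_iff[OF N])
    show ?thesis
    proof
      assume inj: "inj_on ?c (carrier M)"
      show ?separated
      proof (intro ballI impI)
        fix x assume "x \<in> carrier M" "\<forall>i. x \<in> ?N i"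
        then have "?c x = ?c \<zero>\<^bsub>M\<^esub>"
          by (simp add: c_eq diff_zero)
        then show "x = \<zero>\<^bsub>M\<^esub>"
          using inj \<open>x \<in> carrier M\<close> by (auto dest: inj_onD)
      qed
    next
      assume sep: ?separated
      show "inj_on ?c (carrier M)"
      proof (rule inj_onI)
        fix x y assume xy: "x \<in> carrier M" "y \<in> carrier M" "?c x = ?c y"
        then have "x \<ominus>\<^bsub>M\<^esub> y = \<zero>\<^bsub>M\<^esub>"
          using sep c_eq by simp
        then show "x = y"
          using xy eq_if_diff_zero by blast
      qed
    qed
  qed
  also have "carrier ?L \<subseteq> ?c ` carrier M \<longleftrightarrow> ?convergent"
  proof
    assume surj: "carrier ?L \<subseteq> ?c ` carrier M"
    show ?convergent
    proof (intro allI impI)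
      fix x assume x: "\<forall>i. x i \<in> carrier M \<and> x (Suc i) \<ominus>\<^bsub>M\<^esub> x i \<in> ?N i"
      \<comment> \<open>The filtration decreases, so the consecutive differences from index i on all
        lie in \<open>?N i\<close>, and so do their telescoping sums. This is the compatibility
        needed for a point of the limit.\<close>
      have diff: "x j \<ominus>\<^bsub>M\<^esub> x i \<in> ?N i" if "i \<le> j" for i j
        using that
      proof (induction rule: dec_induct)
        case base
        show ?case
          using x submodule_zero_closed[OF N] by (simp add: M.minus_eq M.r_neg)
      next
        case (step j)
        then have "x (Suc j) \<ominus>\<^bsub>M\<^esub> x j \<in> ?N i"
          using x adic_submodule_antimono[OF I, of i j] by blast
        then show ?case
          using x step submodule_diff_trans[OF N] by blast
      qed
      have "(\<lambda>i. ?N i +>\<^bsub>M\<^esub> x i) \<in> carrier ?L"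
        using x diff rcosets_I
        by (simp add: carrier_L quotient_proj_rcoset[OF N N adic_submodule_antimono[OF I]]
            rcoset_eq_iff[OF N])
      then obtain y where "y \<in> carrier M" "(\<lambda>i. ?N i +>\<^bsub>M\<^esub> x i) = ?c y"
        using surj by blast
      then have "?N i +>\<^bsub>M\<^esub> y = ?N i +>\<^bsub>M\<^esub> x i" for i
        by (simp add: adic_canonical_def fun_eq_iff)
      then show "\<exists>y \<in> carrier M. \<forall>i. y \<ominus>\<^bsub>M\<^esub> x i \<in> ?N i"
        using \<open>y \<in> carrier M\<close> x rcoset_eq_iff[OF N] by blast
    qed
  next
    assume conv: ?convergent
    show "carrier ?L \<subseteq> ?c ` carrier M"
    proof
      fix X assume X: "X \<in> carrier ?L"
      then have "\<forall>i. \<exists>x. x \<in> carrier M \<and> X i = ?N i +>\<^bsub>M\<^esub> x"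
        by (simp add: carrier_L A_RCOSETS_def') blast
      then obtain x where x: "\<And>i. x i \<in> carrier M" "\<And>i. X i = ?N i +>\<^bsub>M\<^esub> x i"
        by metis
      \<comment> \<open>The representatives were chosen independently of each other; the transition
        map from level \<open>Suc i\<close> to level i makes neighbours congruent.\<close>
      have "x (Suc i) \<ominus>\<^bsub>M\<^esub> x i \<in> ?N i" for i
      proof -
        have "quotient_proj M (?N i) (X (Suc i)) = X i"
          using X by (simp add: carrier_L)
        then show ?thesis
          using x(1)
          by (simp add: x(2) rcoset_eq_iff[OF N]
              quotient_proj_rcoset[OF N N adic_submodule_antimono[OF I]])
      qed
      then obtain y where y: "y \<in> carrier M" "\<And>i. y \<ominus>\<^bsub>M\<^esub> x i \<in> ?N i"
        using conv x(1) by blast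
      then have "X = ?c y"
        using x submodule_diff_commute[OF N]
        by (auto simp: adic_canonical_def fun_eq_iff rcoset_eq_iff[OF N])
      then show "X \<in> ?c ` carrier M"
        using y by blast
    qed
  qed
  finally show ?thesis .
qed

section \<open>Descent from J to the finitely generated ideal I\<close>

lemma adically_complete_separated:
  assumes "ideal I R" "adically_complete R I M" "x \<in> carrier M" "\<And>i. x \<in> adic_submodule R I M i"
  shows "x = \<zero>\<^bsub>M\<^esub>"
  using assms adically_complete_iff by blast

lemma adically_complete_limit:
  assumes "ideal I R" "adically_complete R I M"
    and "\<And>i. x i \<in> carrier M" "\<And>i. x (Suc i) \<ominus>\<^bsub>M\<^esub> x i \<in> adic_submodule R I M i"
  obtains y where "y \<in> carrier M" "\<And>i. y \<ominus>\<^bsub>M\<^esub> x i \<in> adic_submodule R I M i"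
  using assms adically_complete_iff by blast

text \<open>Induction on i, with x and y arbitrary because the induction hypothesis is applied to
  sequences of coefficients instead of x. The offset in \<open>k + i\<close> makes every difference
  start at depth i, so it is enough to speak of \<open>x 0\<close>: other terms are reached by
  shifting the sequence.\<close>

lemma adic_limit_diff_mem:
  assumes S: "finite S" "S \<subseteq> carrier R" and I: "I = Idl S"
    and J: "ideal J R" and IJ: "I \<subseteq> J" and complete: "adically_complete R J M"
    and x: "\<And>k. x k \<in> carrier M" "\<And>k. x (Suc k) \<ominus>\<^bsub>M\<^esub> x k \<in> adic_submodule R I M (k + i)"
    and y: "y \<in> carrier M" "\<And>k. y \<ominus>\<^bsub>M\<^esub> x k \<in> adic_submodule R J M k"
  shows "y \<ominus>\<^bsub>M\<^esub> x 0 \<in> adic_submodule R I M i"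
  using x y
proof (induction i arbitrary: x y)
  case 0
  then show ?case
    by (simp add: adic_submodule_0)
next
  case (Suc i)
  have idl: "ideal I R"
    unfolding I by (rule genideal_ideal) fact
  \<comment> \<open>Splitting off a generator costs one power of I: the differences lie at depth
    \<open>k + Suc i\<close>, their coefficients at depth \<open>k + i\<close>, as the induction
    hypothesis demands.\<close>
  have "\<exists>v. v \<in> S \<rightarrow> adic_submodule R I M (k + i) \<and>
      x (Suc k) \<ominus>\<^bsub>M\<^esub> x k = (\<Oplus>\<^bsub>M\<^esub>s\<in>S. s \<odot>\<^bsub>M\<^esub> v s)" for k
    using Suc.prems(2)[of k] adic_submodule_Suc_finite[OF S I] by (metis add_Suc_right)
  then obtain v where v: "\<And>k. v k \<in> S \<rightarrow> adic_submodule R I M (k + i)"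
    "\<And>k. x (Suc k) \<ominus>\<^bsub>M\<^esub> x k = (\<Oplus>\<^bsub>M\<^esub>s\<in>S. s \<odot>\<^bsub>M\<^esub> v k s)"
    by metis
  have vM: "v k s \<in> carrier M" if "s \<in> S" for k s
    using v(1)[of k] that submoduleE(1)[OF submodule_adic[OF idl]] by blast
  \<comment> \<open>Partial sums of the coefficients of s. They start at zero, so the induction
    hypothesis, which bounds the limit minus the term at index 0, bounds the limit itself.\<close>
  define w where "w k s = rec_nat \<zero>\<^bsub>M\<^esub> (\<lambda>j z. z \<oplus>\<^bsub>M\<^esub> v j s) k" for k s
  have w_0: "w 0 s = \<zero>\<^bsub>M\<^esub>" and w_Suc: "w (Suc k) s = w k s \<oplus>\<^bsub>M\<^esub> v k s" for k s
    by (simp_all add: w_def)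
  have wM: "w k s \<in> carrier M" if "s \<in> S" for k s
    by (induction k) (use that vM in \<open>auto simp: w_0 w_Suc\<close>)
  have w_diff: "w (Suc k) s \<ominus>\<^bsub>M\<^esub> w k s = v k s" if "s \<in> S" for k s
    using wM[OF that] vM[OF that]
    by (simp add: w_Suc M.minus_eq M.a_ac M.r_neg M.r_neg1 M.r_neg2)
  have sR: "s \<in> carrier R" if "s \<in> S" for s
    using that S by blast
  have "\<exists>z. z \<in> carrier M \<and> (\<forall>k. z \<ominus>\<^bsub>M\<^esub> w k s \<in> adic_submodule R J M k) \<and>
      z \<in> adic_submodule R I M i" if s: "s \<in> S" for s
  proof -
    have diff_I: "w (Suc k) s \<ominus>\<^bsub>M\<^esub> w k s \<in> adic_submodule R I M (k + i)" for k
      using v(1)[of k] w_diff[OF s] s by auto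
    \<comment> \<open>I^(k+i) M lies in I^k M, which lies in J^k M, so the partial sums converge
      J-adically.\<close>
    have "w (Suc k) s \<ominus>\<^bsub>M\<^esub> w k s \<in> adic_submodule R J M k" for k
      by (rule subsetD[OF adic_submodule_mono[OF IJ]],
          rule subsetD[OF adic_submodule_antimono[OF idl le_add1]], rule diff_I)
    then obtain z where z: "z \<in> carrier M" "\<And>k. z \<ominus>\<^bsub>M\<^esub> w k s \<in> adic_submodule R J M k"
      using adically_complete_limit[OF J complete, of "\<lambda>k. w k s"] wM[OF s] by blast
    have "z \<ominus>\<^bsub>M\<^esub> w 0 s \<in> adic_submodule R I M i"
      by (rule Suc.IH[of "\<lambda>k. w k s"]) (rule wM[OF s] diff_I z)+
    then show ?thesis
      using z by (auto simp: w_0 diff_zero)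
  qed
  then obtain z where z: "\<And>s. s \<in> S \<Longrightarrow> z s \<in> carrier M"
    "\<And>s k. s \<in> S \<Longrightarrow> z s \<ominus>\<^bsub>M\<^esub> w k s \<in> adic_submodule R J M k"
    "\<And>s. s \<in> S \<Longrightarrow> z s \<in> adic_submodule R I M i"
    by metis
  define Z where "Z = (\<Oplus>\<^bsub>M\<^esub>s\<in>S. s \<odot>\<^bsub>M\<^esub> z s)"
  define W where "W k = (\<Oplus>\<^bsub>M\<^esub>s\<in>S. s \<odot>\<^bsub>M\<^esub> w k s)" for k
  have ZM: "Z \<in> carrier M" and WM: "W k \<in> carrier M" for k
    unfolding Z_def W_def using sR z(1) wM by (auto intro!: M.finsum_closed)
  \<comment> \<open>Each limit \<open>z s\<close> lies in I^i M by induction, and the factor s from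
    I restores the power that was split off.\<close>
  have Z_I: "Z \<in> adic_submodule R I M (Suc i)"
    unfolding Z_def
  proof (rule finsum_closed_submodule[OF submodule_adic[OF idl] S(1)], rule Pi_I)
    fix s assume s: "s \<in> S"
    then have "s \<in> I"
      unfolding I using genideal_self[OF S(2)] by blast
    then show "s \<odot>\<^bsub>M\<^esub> z s \<in> adic_submodule R I M (Suc i)"
      using smult_adic_submodule_Suc[OF idl] z(3)[OF s] by blast
  qed
  \<comment> \<open>Telescoping: combining the partial sums of coefficients recovers the sum of the
    first k differences of x.\<close>
  have W: "x k = x 0 \<oplus>\<^bsub>M\<^esub> W k" for k
  proof (induction k)
    case 0
    have "W 0 = (\<Oplus>\<^bsub>M\<^esub>s\<in>S. \<zero>\<^bsub>M\<^esub>)"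
      unfolding W_def using sR by (intro M.finsum_cong') (auto simp: w_0)
    then show ?case
      using Suc.prems by simp
  next
    case (Suc k)
    have "W (Suc k) = (\<Oplus>\<^bsub>M\<^esub>s\<in>S. s \<odot>\<^bsub>M\<^esub> w k s \<oplus>\<^bsub>M\<^esub> s \<odot>\<^bsub>M\<^esub> v k s)"
      unfolding W_def using sR wM vM
      by (intro M.finsum_cong') (auto simp: w_Suc smult_r_distr)
    also have "\<dots> = W k \<oplus>\<^bsub>M\<^esub> (x (Suc k) \<ominus>\<^bsub>M\<^esub> x k)"
      unfolding W_def v(2) using sR wM vM by (intro M.finsum_addf) auto
    finally have "x 0 \<oplus>\<^bsub>M\<^esub> W (Suc k) = x k \<oplus>\<^bsub>M\<^esub> (x (Suc k) \<ominus>\<^bsub>M\<^esub> x k)"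
      using Suc Suc.prems WM \<open>\<And>k. x k \<in> carrier M\<close> by (simp add: M.a_assoc)
    then show ?case
      using \<open>\<And>k. x k \<in> carrier M\<close> by (simp add: add_diff_cancel)
  qed
  have Z_W: "Z \<ominus>\<^bsub>M\<^esub> W k \<in> adic_submodule R J M k" for k
  proof -
    have "Z = (\<Oplus>\<^bsub>M\<^esub>s\<in>S. s \<odot>\<^bsub>M\<^esub> (z s \<ominus>\<^bsub>M\<^esub> w k s) \<oplus>\<^bsub>M\<^esub> s \<odot>\<^bsub>M\<^esub> w k s)"
      unfolding Z_def using sR wM z(1)
      by (intro M.finsum_cong') (auto simp: smult_diff_right diff_add_cancel)
    also have "\<dots> = (\<Oplus>\<^bsub>M\<^esub>s\<in>S. s \<odot>\<^bsub>M\<^esub> (z s \<ominus>\<^bsub>M\<^esub> w k s)) \<oplus>\<^bsub>M\<^esub> W k"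
      unfolding W_def using sR wM z(1) by (intro M.finsum_addf) auto
    finally have *: "Z = (\<Oplus>\<^bsub>M\<^esub>s\<in>S. s \<odot>\<^bsub>M\<^esub> (z s \<ominus>\<^bsub>M\<^esub> w k s)) \<oplus>\<^bsub>M\<^esub> W k" .
    have D: "(\<Oplus>\<^bsub>M\<^esub>s\<in>S. s \<odot>\<^bsub>M\<^esub> (z s \<ominus>\<^bsub>M\<^esub> w k s)) \<in> adic_submodule R J M k" (is "?D \<in> _")
      using sR z(2) submoduleE(4)[OF submodule_adic[OF J]]
      by (intro finsum_closed_submodule[OF submodule_adic[OF J] S(1)]) auto
    then have "?D \<in> carrier M"
      using submoduleE(1)[OF submodule_adic[OF J]] by blast
    then have "Z \<ominus>\<^bsub>M\<^esub> W k = ?D"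
      using WM[of k] unfolding * by (simp add: M.minus_eq M.a_assoc M.r_neg)
    then show ?thesis
      using D by simp
  qed
  \<comment> \<open>Both y - x k and Z - W k lie in J^k M, and their difference does not depend on k
    because x k = x 0 + W k. So y - x 0 - Z lies in every J^k M and vanishes by
    separatedness.\<close>
  have "(y \<ominus>\<^bsub>M\<^esub> x 0) \<ominus>\<^bsub>M\<^esub> Z \<in> adic_submodule R J M k" for k
  proof -
    have "(y \<ominus>\<^bsub>M\<^esub> x 0) \<ominus>\<^bsub>M\<^esub> Z = (y \<ominus>\<^bsub>M\<^esub> x k) \<ominus>\<^bsub>M\<^esub> (Z \<ominus>\<^bsub>M\<^esub> W k)"
      unfolding W[of k] using Suc.prems ZM WM[of k]
      by (simp add: diff_add_eq_diff_diff diff_diff_diff)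
    then show ?thesis
      using submodule_diff_closed[OF submodule_adic[OF J] Suc.prems(4) Z_W] by simp
  qed
  then have "(y \<ominus>\<^bsub>M\<^esub> x 0) \<ominus>\<^bsub>M\<^esub> Z = \<zero>\<^bsub>M\<^esub>"
    using adically_complete_separated[OF J complete] Suc.prems ZM by simp
  then have "y \<ominus>\<^bsub>M\<^esub> x 0 = Z"
    using eq_if_diff_zero Suc.prems ZM by simp
  then show ?case
    using Z_I by simp
qed

lemma adically_complete_subideal:
  assumes S: "finite S" "S \<subseteq> carrier R" and I: "I = Idl S"
    and J: "ideal J R" and IJ: "I \<subseteq> J" and complete: "adically_complete R J M"
  shows "adically_complete R I M"
proof -
  have idl: "ideal I R"
    unfolding I by (rule genideal_ideal) fact
  note sub = adic_submodule_mono[OF IJ]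
  show ?thesis
    unfolding adically_complete_iff[OF idl]
  proof (intro conjI ballI allI impI)
    fix x assume "x \<in> carrier M" "\<forall>i. x \<in> adic_submodule R I M i"
    then show "x = \<zero>\<^bsub>M\<^esub>"
      using adically_complete_separated[OF J complete] sub by blast
  next
    fix x assume x: "\<forall>i. x i \<in> carrier M \<and> x (Suc i) \<ominus>\<^bsub>M\<^esub> x i \<in> adic_submodule R I M i"
    then obtain y where y: "y \<in> carrier M" "\<And>i. y \<ominus>\<^bsub>M\<^esub> x i \<in> adic_submodule R J M i"
      using adically_complete_limit[OF J complete, of x] sub by blast
    \<comment> \<open>The previous lemma is used for the shifted sequence k |-> x (k + i), whose
      initial term is written \<open>x (0 + i)\<close> to match. Its J-adic limit is still y, since
      J^(k+i) M lies in J^k M.\<close>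
    have "y \<ominus>\<^bsub>M\<^esub> x (0 + i) \<in> adic_submodule R I M i" for i
    proof (rule adic_limit_diff_mem[OF S I J IJ complete])
      show "y \<ominus>\<^bsub>M\<^esub> x (k + i) \<in> adic_submodule R J M k" for k
        using y(2)[of "k + i"] adic_submodule_antimono[OF J, of k "k + i"] by auto
    qed (use x y in auto)
    then show "\<exists>y \<in> carrier M. \<forall>i. y \<ominus>\<^bsub>M\<^esub> x i \<in> adic_submodule R I M i"
      using y(1) by auto
  qed
qed

end

theorem corollary0p2:
  fixes A :: "('a, 'r) ring_scheme"
    and M :: "('a, 'b, 'm) module_scheme"
    and \<aa> \<bb> :: "'a set"
  assumes "cring A"
    and "ideal \<aa> A"
    and "\<exists>S \<subseteq> carrier A. finite S \<and> \<aa> = Idl\<^bsub>A\<^esub> S"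
    and "ideal \<bb> A"
    and "\<aa> \<subseteq> \<bb>"
    and "module A M"
    and "adically_complete A \<bb> M"
  shows "adically_complete A \<aa> M"
  using assms module.adically_complete_subideal by blast

end
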